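(* Let $\xi_l\sim\mathcal{N}(\mu_l,\sigma_l)$, $l=1,2,\ldots,L$, be independent normal random variables, and let $U_l$, $l=1,2,\ldots,L$, be nonnegative (deterministic, real) variables. Then for every tolerance level $\epsilon\in(0,0.5]$, the constraint $$Pr\Big(\sum_{l=1}^{L}\xi_lU_l\le 1\Big)\ge 1-\epsilon$$ is equivalent to $$\sum_{l=1}^{L}\mu_lU_l+\Phi^{-1}(1-\epsilon)\sqrt{\sum_{l=1}^{L}\sigma_l^2U_l^2}\le 1,$$ where $\Phi^{-1}(1-\epsilon)=\sqrt{2}\,\mathrm{erf}^{-1}(1-2\epsilon)$ is the inverse of the standard normal distribution function evaluated at $1-\epsilon$.
   Context: $\xi\sim\mathcal{N}(\mu,\sigma)$, with $\mu\in\mathbb{R}$ and $\sigma>0$, means that the real random variable $\xi$ is normal with mean $\mu$ and standard deviation $\sigma$ (the second parameter is the standard deviation, not the variance). $Pr$ denotes probability. $\Phi(x)=\frac12\big[1+\mathrm{erf}\big(\frac{x}{\sqrt2}\big)\big]$ is the standard normal distribution function, with $\mathrm{erf}(z)=\frac{2}{\sqrt{\pi}}\int_0^z e^{-t^2}\,dt$. *)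

theory Defs
  imports "HOL-Probability.Probability"
begin

text \<open>The oriented interval integral makes \<open>erf\<close> odd, as required for negative arguments.\<close>

definition erf :: "real \<Rightarrow> real" where
  "erf z = 2 / sqrt pi * (LBINT t=0..z. exp (- t\<^sup>2))"

definition std_normal_cdf :: "real \<Rightarrow> real" where
  "std_normal_cdf x = 1 / 2 * (1 + erf (x / sqrt 2))"

text \<open>
  Both functions below are inverses of strictly increasing functions; their values are meaningful
  only on the ranges \<open>{-1<..<1}\<close> of \<open>erf\<close> and \<open>{0<..<1}\<close> of \<open>std_normal_cdf\<close>.
\<close>

definition erf_inv :: "real \<Rightarrow> real" where
  "erf_inv = the_inv erf"

definition std_normal_quantile :: "real \<Rightarrow> real" where
  "std_normal_quantile = the_inv std_normal_cdf"

end

theory Submission imports Defs begin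

text \<open>
  A nonnegative combination of independent normal variables is normal with mean
  \<open>m = \<Sum>\<mu>\<^sub>lU\<^sub>l\<close> and variance \<open>s\<^sup>2 = \<Sum>\<sigma>\<^sub>l\<^sup>2U\<^sub>l\<^sup>2\<close>, so the constraint reads
  \<open>\<Phi> ((1 - m) / s) \<ge> 1 - \<epsilon>\<close>; applying the increasing function \<open>\<Phi>\<^sup>-\<^sup>1\<close> gives the claim.
  If all \<open>U\<^sub>l\<close> vanish, the sum is identically 0 and both sides hold.
\<close>

lemma has_field_derivative_erf:
  "(erf has_field_derivative 2 / sqrt pi * exp (- x\<^sup>2)) (at x)"
proof -
  \<comment> \<open>The interval \<open>{a..b}\<close> contains 0, the base point of the integral,
    and has \<open>x\<close> in its interior, so the derivative within \<open>{a..b}\<close> is a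
    full derivative at \<open>x\<close>.\<close>
  define a where "a = min 0 x - 1"
  define b where "b = max 0 x + 1"
  have ab: "a < x" "x < b" "a \<le> 0" "0 \<le> b"
    by (auto simp: a_def b_def)
  have "((\<lambda>u. LBINT t=ereal 0..ereal u. exp (- t\<^sup>2)) has_vector_derivative exp (- x\<^sup>2))
      (at x within {a..b})"
    using ab by (intro interval_integral_FTC2) (auto intro!: continuous_intros)
  then have "((\<lambda>u. LBINT t=ereal 0..ereal u. exp (- t\<^sup>2)) has_field_derivative exp (- x\<^sup>2)) (at x)"
    using ab by (simp add: has_real_derivative_iff_has_vector_derivative at_within_Icc_at)
  from DERIV_cmult[OF this, of "2 / sqrt pi"] show ?thesis
    unfolding erf_def[abs_def] by (simp add: zero_ereal_def)
qed

lemma erf_0 [simp]: "erf 0 = 0"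
  by (simp add: erf_def flip: zero_ereal_def)

text \<open>The derivative of \<open>erf\<close> is even, so \<open>erf x + erf (- x)\<close> has
  derivative 0 and keeps its value at 0.\<close>

lemma erf_minus: "erf (- x) = - erf x"
proof -
  have "\<forall>x. ((\<lambda>x. erf x + erf (- x)) has_field_derivative 0) (at x)"
    using DERIV_add[OF has_field_derivative_erf
      DERIV_chain2[OF has_field_derivative_erf DERIV_minus[OF DERIV_ident]]] by simp
  from DERIV_isconst_all[OF this, of x 0] show ?thesis
    by simp
qed

lemma strict_mono_erf: "strict_mono erf"
proof (rule strict_monoI)
  fix x y :: real
  assume "x < y"
  then show "erf x < erf y"
  proof (rule DERIV_pos_imp_increasing)
    show "\<exists>D. (erf has_field_derivative D) (at z) \<and> 0 < D" for z
      by (rule exI, rule conjI, rule has_field_derivative_erf) simp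
  qed
qed

lemma has_field_derivative_std_normal_cdf:
  "(std_normal_cdf has_field_derivative std_normal_density x) (at x)"
proof -
  have "((\<lambda>x. erf (x / sqrt 2)) has_field_derivative
      2 / sqrt pi * exp (- (x / sqrt 2)\<^sup>2) * (1 / sqrt 2)) (at x)"
    by (rule DERIV_chain2[OF has_field_derivative_erf DERIV_cdivide[OF DERIV_ident]])
  then have "(std_normal_cdf has_field_derivative
      1 / 2 * (0 + 2 / sqrt pi * exp (- (x / sqrt 2)\<^sup>2) * (1 / sqrt 2))) (at x)"
    unfolding std_normal_cdf_def[abs_def] by (intro DERIV_cmult DERIV_add DERIV_const)
  also have "1 / 2 * (0 + 2 / sqrt pi * exp (- (x / sqrt 2)\<^sup>2) * (1 / sqrt 2))
      = 1 / (sqrt 2 * sqrt pi) * exp (- (x / sqrt 2)\<^sup>2)"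
    by simp
  also have "\<dots> = std_normal_density x"
    by (simp add: std_normal_density_def real_sqrt_mult power_divide)
  finally show ?thesis .
qed

lemma isCont_std_normal_cdf: "isCont std_normal_cdf x"
  using has_field_derivative_std_normal_cdf by (rule DERIV_isCont)

lemma strict_mono_std_normal_cdf: "strict_mono std_normal_cdf"
  using strict_mono_erf
  by (simp add: strict_mono_def std_normal_cdf_def divide_strict_right_mono)

lemma std_normal_cdf_minus: "std_normal_cdf (- x) = 1 - std_normal_cdf x"
  using erf_minus[of "x / sqrt 2"] by (simp add: std_normal_cdf_def diff_divide_distrib add_divide_distrib)

text \<open>Since \<open>std_normal_cdf\<close> is an antiderivative of the density, this identifies
  the increments of the true distribution function; only an additive constant remains open.\<close>

lemma measure_std_normal_Ioc:
  assumes "a \<le> b"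
  shows "measure (density lborel std_normal_density) {a<..b} = std_normal_cdf b - std_normal_cdf a"
proof -
  have "measure (density lborel std_normal_density) {a<..b}
      = (\<integral>x. indicator {a<..b} x \<partial>density lborel std_normal_density)"
    by simp
  also have "\<dots> = (LBINT x:{a<..b}. std_normal_density x)"
    by (subst integral_density) (auto simp: set_lebesgue_integral_def mult.commute)
  also have "\<dots> = (LBINT x=a..b. std_normal_density x)"
    using assms by (simp add: interval_integral_Ioc)
  also have "\<dots> = std_normal_cdf b - std_normal_cdf a"
  proof (rule interval_integral_FTC_finite)
    show "continuous_on {min a b..max a b} std_normal_density"
      unfolding std_normal_density_def[abs_def] by (intro continuous_intros) simp
    show "(std_normal_cdf has_vector_derivative std_normal_density x) (at x within {min a b..max a b})" for x
      using has_field_derivative_std_normal_cdf[of x]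
      unfolding has_real_derivative_iff_has_vector_derivative
      by (rule has_vector_derivative_at_within)
  qed
  finally show ?thesis .
qed

lemma real_distribution_std_normal: "real_distribution (density lborel std_normal_density)"
  using prob_space_normal_density[of 1 0]
  by (simp add: real_distribution_def real_distribution_axioms_def)

text \<open>
  By the fundamental theorem of calculus the two sides differ by a constant, and the reflection
  \<open>\<Phi> (- x) = 1 - \<Phi> x\<close> together with the limits at \<open>\<plusminus>\<infinity>\<close> forces it to be 0.
\<close>
lemma cdf_std_normal: "cdf (density lborel std_normal_density) = std_normal_cdf"
proof -
  interpret N: real_distribution "density lborel std_normal_density"
    by (rule real_distribution_std_normal)
  let ?G = "cdf (density lborel std_normal_density)"
  define c where "c = std_normal_cdf 0 - ?G 0"
  have G: "?G x = std_normal_cdf x - c" for x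
    \<comment> \<open>The increment between \<open>x\<close> and 0 is taken in whichever order makes
      it an interval; at \<open>x = 0\<close> the claim is the definition of
      \<open>c\<close>.\<close>
    using N.cdf_diff_eq[of x 0] N.cdf_diff_eq[of 0 x]
      measure_std_normal_Ioc[of x 0] measure_std_normal_Ioc[of 0 x]
    by (cases x "0::real" rule: linorder_cases) (auto simp: c_def)
  have "((\<lambda>x. ?G (- x)) \<longlongrightarrow> 0) at_top"
    by (rule filterlim_compose[OF N.cdf_lim_at_bot filterlim_uminus_at_bot_at_top])
  moreover have "(\<lambda>x. ?G (- x)) = (\<lambda>x. 1 - 2 * c - ?G x)"
    by (simp add: G std_normal_cdf_minus fun_eq_iff)
  moreover have "((\<lambda>x. 1 - 2 * c - ?G x) \<longlongrightarrow> 1 - 2 * c - 1) at_top"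
    by (intro tendsto_intros N.cdf_lim_at_top_prob)
  ultimately have "c = 0"
    using tendsto_unique[of at_top "\<lambda>x. ?G (- x)" 0 "1 - 2 * c - 1"] by auto
  with G show ?thesis
    by auto
qed

text \<open>The limits 0 and 1 of the distribution function give points with values below and above
  \<open>p\<close>; the intermediate value theorem does the rest. This places \<open>p\<close> in
  the range where \<open>the_inv\<close> is a true inverse.\<close>

lemma std_normal_cdf_surj:
  assumes "0 < p" "p < 1"
  obtains x where "std_normal_cdf x = p"
proof -
  interpret N: real_distribution "density lborel std_normal_density"
    by (rule real_distribution_std_normal)
  have "\<forall>\<^sub>F x in at_bot. std_normal_cdf x < p"
    using N.cdf_lim_at_bot assms unfolding cdf_std_normal by (intro order_tendstoD(2))
  then obtain a where a: "std_normal_cdf a < p"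
    by (auto simp: eventually_at_bot_linorder)
  have "\<forall>\<^sub>F x in at_top. p < std_normal_cdf x"
    using N.cdf_lim_at_top_prob assms unfolding cdf_std_normal by (intro order_tendstoD(1))
  then obtain b where b: "p < std_normal_cdf b"
    by (auto simp: eventually_at_top_linorder)
  have "a \<le> b"
    using a b strict_mono_less[OF strict_mono_std_normal_cdf, of a b] by simp
  then show ?thesis
    using IVT[of std_normal_cdf a p b] a b isCont_std_normal_cdf that by auto
qed

lemma std_normal_cdf_quantile:
  assumes "0 < p" "p < 1"
  shows "std_normal_cdf (std_normal_quantile p) = p"
  using std_normal_cdf_surj[OF assms] strict_mono_imp_inj_on[OF strict_mono_std_normal_cdf]
  unfolding std_normal_quantile_def by (metis the_inv_f_f)

text \<open>The quantile itself provides a preimage of \<open>2 * p - 1\<close> under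
  \<open>erf\<close>, so injectivity of \<open>erf\<close> suffices to evaluate
  \<open>erf_inv\<close> there.\<close>

lemma std_normal_quantile_eq_erf_inv:
  assumes "0 < p" "p < 1"
  shows "std_normal_quantile p = sqrt 2 * erf_inv (2 * p - 1)"
proof -
  have "erf (std_normal_quantile p / sqrt 2) = 2 * p - 1"
    using std_normal_cdf_quantile[OF assms] by (simp add: std_normal_cdf_def)
  then have "erf_inv (2 * p - 1) = std_normal_quantile p / sqrt 2"
    using the_inv_f_f[OF strict_mono_imp_inj_on[OF strict_mono_erf]]
    unfolding erf_inv_def by metis
  then show ?thesis
    by simp
qed

text \<open>Standardization: \<open>(X - m) / s\<close> is standard normal, and dividing by
  \<open>s > 0\<close> preserves the inequality.\<close>

lemma (in prob_space) prob_normal_le: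
  assumes "0 < s" "distributed M lborel X (normal_density m s)"
  shows "\<P>(\<omega> in M. X \<omega> \<le> a) = std_normal_cdf ((a - m) / s)"
proof -
  let ?Z = "\<lambda>\<omega>. (X \<omega> - m) / s"
  have Z: "distributed M lborel ?Z std_normal_density"
    using assms normal_standard_normal_convert by blast
  have "\<P>(\<omega> in M. X \<omega> \<le> a) = measure M (?Z -` {..(a - m) / s} \<inter> space M)"
    using assms(1) by (intro arg_cong[where f = "measure M"]) (auto simp: divide_le_cancel)
  also have "\<dots> = measure (distr M lborel ?Z) {..(a - m) / s}"
    using distributed_measurable[OF Z] by (subst measure_distr) auto
  also have "\<dots> = std_normal_cdf ((a - m) / s)"
    unfolding distributed_distr_eq_density[OF Z] cdf_std_normal[symmetric] cdf_def ..
  finally show ?thesis .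
qed

lemma (in prob_space) linear_combination_indep_normal:
  assumes "finite I" "indep_vars (\<lambda>_. borel) X I"
    and "\<And>i. i \<in> I \<Longrightarrow> 0 < \<sigma> i"
    and "\<And>i. i \<in> I \<Longrightarrow> distributed M lborel (X i) (normal_density (\<mu> i) (\<sigma> i))"
    and "\<exists>i\<in>I. c i \<noteq> 0"
  shows "distributed M lborel (\<lambda>\<omega>. \<Sum>i\<in>I. X i \<omega> * c i)
    (normal_density (\<Sum>i\<in>I. \<mu> i * c i) (sqrt (\<Sum>i\<in>I. (\<sigma> i)\<^sup>2 * (c i)\<^sup>2)))"
proof -
  \<comment> \<open>A term with \<open>c i = 0\<close> is constant and has no normal density, so the
    sum theorem for independent normals is applied only to the indices in \<open>J\<close>; the
    others contribute 0 to all three sums.\<close>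
  define J where "J = {i\<in>I. c i \<noteq> 0}"
  have J: "J \<subseteq> I" "finite J" "J \<noteq> {}"
    using assms by (auto simp: J_def)
  have sum_J: "(\<Sum>i\<in>I. f i) = (\<Sum>i\<in>J. f i)" if "\<And>i. c i = 0 \<Longrightarrow> f i = 0" for f :: "'b \<Rightarrow> real"
    using assms(1) that by (intro sum.mono_neutral_right) (auto simp: J_def)
  have "indep_vars (\<lambda>_. borel) (\<lambda>i \<omega>. X i \<omega> * c i) J"
    by (rule indep_vars_compose2[OF indep_vars_subset[OF assms(2) J(1)]]) simp
  moreover have "0 < \<bar>c i\<bar> * \<sigma> i" if "i \<in> J" for i
    using that assms(3) by (simp add: J_def)
  \<comment> \<open>Coefficients may be negative here, hence the absolute value in the standard
    deviation; it disappears on squaring.\<close>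
  moreover have "distributed M lborel (\<lambda>\<omega>. X i \<omega> * c i) (normal_density (\<mu> i * c i) (\<bar>c i\<bar> * \<sigma> i))"
    if "i \<in> J" for i
    using that normal_density_affine[OF assms(4,3), of i "c i" 0] by (simp add: J_def mult.commute)
  ultimately have "distributed M lborel (\<lambda>\<omega>. \<Sum>i\<in>J. X i \<omega> * c i)
      (normal_density (\<Sum>i\<in>J. \<mu> i * c i) (sqrt (\<Sum>i\<in>J. (\<bar>c i\<bar> * \<sigma> i)\<^sup>2)))"
    using J by (intro sum_indep_normal) auto
  moreover have "(\<Sum>i\<in>I. X i \<omega> * c i) = (\<Sum>i\<in>J. X i \<omega> * c i)" for \<omega>
    by (rule sum_J) simp
  moreover have "(\<Sum>i\<in>I. \<mu> i * c i) = (\<Sum>i\<in>J. \<mu> i * c i)"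
    by (rule sum_J) simp
  moreover have "(\<Sum>i\<in>I. (\<sigma> i)\<^sup>2 * (c i)\<^sup>2) = (\<Sum>i\<in>J. (\<bar>c i\<bar> * \<sigma> i)\<^sup>2)"
    by (subst sum_J) (auto simp: power_mult_distrib mult.commute)
  ultimately show ?thesis
    by simp
qed

theorem theorem6:
  fixes M :: "'a measure"
    and L :: nat
    and \<xi> :: "nat \<Rightarrow> 'a \<Rightarrow> real"
    and \<mu> \<sigma> U :: "nat \<Rightarrow> real"
    and \<epsilon> :: real
  assumes "prob_space M"
    and "\<And>l. l \<in> {1..L} \<Longrightarrow> 0 < \<sigma> l"
    and "\<And>l. l \<in> {1..L} \<Longrightarrow> distributed M lborel (\<xi> l) (normal_density (\<mu> l) (\<sigma> l))"
    and "prob_space.indep_vars M (\<lambda>_. borel) \<xi> {1..L}"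
    and "\<And>l. l \<in> {1..L} \<Longrightarrow> 0 \<le> U l"
    and "\<epsilon> \<in> {0<..1/2}"
  shows "(\<P>(\<omega> in M. (\<Sum>l=1..L. \<xi> l \<omega> * U l) \<le> 1) \<ge> 1 - \<epsilon> \<longleftrightarrow>
          (\<Sum>l=1..L. \<mu> l * U l)
            + std_normal_quantile (1 - \<epsilon>) * sqrt (\<Sum>l=1..L. (\<sigma> l)\<^sup>2 * (U l)\<^sup>2) \<le> 1) \<and>
         std_normal_quantile (1 - \<epsilon>) = sqrt 2 * erf_inv (1 - 2 * \<epsilon>)"
proof
  interpret prob_space M by fact
  let ?X = "\<lambda>\<omega>. \<Sum>l=1..L. \<xi> l \<omega> * U l"
  let ?m = "\<Sum>l=1..L. \<mu> l * U l"
  let ?s = "sqrt (\<Sum>l=1..L. (\<sigma> l)\<^sup>2 * (U l)\<^sup>2)"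
  let ?q = "std_normal_quantile (1 - \<epsilon>)"
  have \<epsilon>: "0 < 1 - \<epsilon>" "1 - \<epsilon> < 1"
    using assms(6) by auto
  from std_normal_quantile_eq_erf_inv[OF this] show "?q = sqrt 2 * erf_inv (1 - 2 * \<epsilon>)"
    by (simp add: algebra_simps)
  show "\<P>(\<omega> in M. ?X \<omega> \<le> 1) \<ge> 1 - \<epsilon> \<longleftrightarrow> ?m + ?q * ?s \<le> 1"
  proof (cases "\<exists>l\<in>{1..L}. U l \<noteq> 0")
    case True
    then have "0 < ?s"
    proof -
      from True obtain k where "k \<in> {1..L}" "U k \<noteq> 0"
        by auto
      then have "0 < (\<Sum>l=1..L. (\<sigma> l)\<^sup>2 * (U l)\<^sup>2)"
        using assms(2)[of k] by (intro sum_pos2[of _ k]) auto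
      then show ?thesis
        by simp
    qed
    have "\<P>(\<omega> in M. ?X \<omega> \<le> 1) = std_normal_cdf ((1 - ?m) / ?s)"
      using \<open>0 < ?s\<close> linear_combination_indep_normal[OF _ assms(4,2,3) True]
      by (intro prob_normal_le) auto
    \<comment> \<open>Writing \<open>1 - \<epsilon>\<close> as \<open>std_normal_cdf ?q\<close> lets
      strict monotonicity reduce the comparison of probabilities to one of arguments.\<close>
    then have "\<P>(\<omega> in M. ?X \<omega> \<le> 1) \<ge> 1 - \<epsilon> \<longleftrightarrow>
        std_normal_cdf ?q \<le> std_normal_cdf ((1 - ?m) / ?s)"
      by (simp only: std_normal_cdf_quantile[OF \<epsilon>])
    also have "\<dots> \<longleftrightarrow> ?q \<le> (1 - ?m) / ?s"
      by (rule strict_mono_less_eq[OF strict_mono_std_normal_cdf])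
    also have "\<dots> \<longleftrightarrow> ?m + ?q * ?s \<le> 1"
      using \<open>0 < ?s\<close> by (simp only: pos_le_divide_eq) linarith
    finally show ?thesis .
  next
    \<comment> \<open>This case includes \<open>L = 0\<close>. The event is the whole space, with
      probability 1, and the right-hand inequality becomes \<open>0 \<le> 1\<close>.\<close>
    case False
    then show ?thesis
      using \<epsilon> by (simp add: prob_space)
  qed
qed

end
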